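(* Let $d\ge 1$. Then $SP=\mathcal{L}_{9}$. Thus any symplectic matrix $H\in\mathbb{R}^{2d\times 2d}$ can be factored into no more than $9$ unit triangular symplectic matrices.
   Context: Let $I=I_d$ be the $d\times d$ identity and $J=\begin{bmatrix} 0 & I_{d} \\ -I_{d} & 0 \end{bmatrix}$. A real $2d\times 2d$ matrix $H$ is symplectic if $H^{T}JH=J$; $SP$ is the set (group) of all symplectic matrices in $\mathbb{R}^{2d\times 2d}$. The unit triangular symplectic matrices are those of the form $\begin{bmatrix} I & S \\ 0 & I\end{bmatrix}$ (upper) or $\begin{bmatrix} I & 0 \\ S & I\end{bmatrix}$ (lower) with $S\in\mathbb{R}^{d\times d}$ symmetric. For $n\ge1$, $\mathcal{L}_{n}$ is the set of all products $M_n\cdots M_2M_1$ where $M_i=\begin{bmatrix} I & S_i \\ 0 & I\end{bmatrix}$ for $i$ odd and $M_i=\begin{bmatrix} I & 0 \\ S_i & I\end{bmatrix}$ for $i$ even, with $S_1,\dots,S_n\in\mathbb{R}^{d\times d}$ arbitrary symmetric matrices (upper and lower factors alternate, the rightmost one being upper). *)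

theory Defs
  imports Complex_Main "Jordan_Normal_Form.Matrix"
begin

definition J_mat :: "nat \<Rightarrow> real mat" where
  "J_mat d = four_block_mat (0\<^sub>m d d) (1\<^sub>m d) (- 1\<^sub>m d) (0\<^sub>m d d)"

definition SP :: "nat \<Rightarrow> real mat set" where
  "SP d = {H \<in> carrier_mat (2 * d) (2 * d). transpose_mat H * J_mat d * H = J_mat d}"

definition symmetric_mats :: "nat \<Rightarrow> real mat set" where
  "symmetric_mats d = {S \<in> carrier_mat d d. transpose_mat S = S}"

definition unit_upper :: "nat \<Rightarrow> real mat \<Rightarrow> real mat" where
  "unit_upper d S = four_block_mat (1\<^sub>m d) S (0\<^sub>m d d) (1\<^sub>m d)"

definition unit_lower :: "nat \<Rightarrow> real mat \<Rightarrow> real mat" where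
  "unit_lower d S = four_block_mat (1\<^sub>m d) (0\<^sub>m d d) S (1\<^sub>m d)"

definition unit_triangular_symplectic :: "nat \<Rightarrow> real mat set" where
  "unit_triangular_symplectic d =
     unit_upper d ` symmetric_mats d \<union> unit_lower d ` symmetric_mats d"

definition alt_factor :: "nat \<Rightarrow> (nat \<Rightarrow> real mat) \<Rightarrow> nat \<Rightarrow> real mat" where
  "alt_factor d S i = (if odd i then unit_upper d (S i) else unit_lower d (S i))"

(* alt_prod d S n = M_n * ... * M_2 * M_1 with M_i = alt_factor d S i *)
primrec alt_prod :: "nat \<Rightarrow> (nat \<Rightarrow> real mat) \<Rightarrow> nat \<Rightarrow> real mat" where
  "alt_prod d S 0 = 1\<^sub>m (2 * d)"
| "alt_prod d S (Suc n) = alt_factor d S (Suc n) * alt_prod d S n"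

definition L_set :: "nat \<Rightarrow> nat \<Rightarrow> real mat set" where
  "L_set d n = {alt_prod d S n | S. \<forall>i\<in>{1..n}. S i \<in> symmetric_mats d}"

end

theory Submission
  imports Defs "Jordan_Normal_Form.Jordan_Normal_Form_Existence"
begin

text \<open>
  Let \<open>H = [A, B; C, D]\<close> be symplectic. Multiplying by an upper factor with parameter \<open>s I\<close> replaces \<open>A\<close> by
  \<open>A + s C\<close>, which is nonsingular for some \<open>s\<close>: otherwise pick kernel vectors \<open>v\<^sub>s \<noteq> 0\<close>; since
  \<open>A\<^sup>T C\<close> is symmetric and \<open>A v\<^sub>s = - s C v\<^sub>s\<close>, the vectors \<open>C v\<^sub>s\<close> are nonzero and pairwise orthogonal,
  and there are infinitely many of them.

  If \<open>A\<close> is nonsingular, then \<open>H\<close> is \<open>diag(A, A\<^bsup>-T\<^esup>)\<close> up to a lower factor on the left and an upper factor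
  on the right. Applied to the product of an upper factor \<open>S\<close> and a lower factor \<open>T\<close>, whose leading block
  is \<open>I + S T\<close>, this gives \<open>diag(X, X\<^bsup>-T\<^esup>) = L U L U\<close> for nonsingular \<open>X = I + S T\<close>.
  So it suffices to write \<open>A = X Y\<close> with \<open>X - I\<close> and \<open>Y - I\<close> products of two symmetric matrices:
  then \<open>H = U (L (L U L U) (L U L U) U)\<close>, and merging neighbours leaves nine factors.

  A Jordan block is a product of two symmetric matrices (reverse the order of its columns), and the property
  is invariant under similarity, so any \<open>X\<close> whose characteristic polynomial splits over the reals will do.
  Every nonsingular \<open>A\<close> is a product of two such matrices: up to similarity its first entry is nonzero,
  and one step of block elimination reduces to the Schur complement.
\<close>

section \<open>Closure properties of symmetric matrices\<close>

lemma symmetric_matsI: "S \<in> carrier_mat n n \<Longrightarrow> transpose_mat S = S \<Longrightarrow> S \<in> symmetric_mats n"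
  by (simp add: symmetric_mats_def)

lemma symmetric_matsD:
  assumes "S \<in> symmetric_mats n"
  shows "S \<in> carrier_mat n n" and "transpose_mat S = S"
  using assms by (auto simp: symmetric_mats_def)

lemma symmetric_mats_add:
  "S \<in> symmetric_mats n \<Longrightarrow> T \<in> symmetric_mats n \<Longrightarrow> S + T \<in> symmetric_mats n"
  by (auto simp: symmetric_mats_def transpose_add)

lemma symmetric_mats_uminus: "S \<in> symmetric_mats n \<Longrightarrow> - S \<in> symmetric_mats n"
  by (auto simp: symmetric_mats_def transpose_uminus)

lemma symmetric_mats_smult_one: "s \<cdot>\<^sub>m 1\<^sub>m n \<in> symmetric_mats n"
  by (auto simp: symmetric_mats_def intro!: eq_matI)

section \<open>Factoring a nonsingular matrix into two matrices with only real eigenvalues\<close>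

text \<open>The list of linear factors, with repetition, is the form in which
  \<open>jordan_nf_exists\<close> takes its hypothesis.\<close>

definition split_char_poly :: "real mat \<Rightarrow> bool" where
  "split_char_poly A \<longleftrightarrow> (\<exists>as. char_poly A = (\<Prod>a\<leftarrow>as. [:- a, 1:]))"

text \<open>Laplace expansion along the first row yields an entry \<open>A $$ (0,j)\<close> that is
  nonzero, and an elementary conjugation moves it into the corner.\<close>

lemma similar_nonzero_pivot:
  fixes A :: "'a :: field mat"
  assumes A: "A \<in> carrier_mat (Suc n) (Suc n)" and det: "det A \<noteq> 0"
  shows "\<exists>B. similar_mat A B \<and> B \<in> carrier_mat (Suc n) (Suc n) \<and> B $$ (0,0) \<noteq> 0"
proof (cases "A $$ (0,0) = 0")
  case False
  then show ?thesis using A similar_mat_refl[OF A] by blast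
next
  case True
  have "\<exists>j<Suc n. A $$ (0,j) \<noteq> 0"
    proof (rule ccontr)
    assume "\<not> ?thesis"
    then have "(\<Sum>j<Suc n. A $$ (0,j) * cofactor A 0 j) = 0" by (intro sum.neutral) auto
    with laplace_expansion_row[OF A zero_less_Suc] det show False by simp
  qed
  then obtain j where j: "j < Suc n" "A $$ (0,j) \<noteq> 0" by blast
  with True have j0: "j \<noteq> 0" by metis
  \<comment> \<open>Column \<open>j\<close> is added to column \<open>0\<close> and row
    \<open>0\<close> subtracted from row \<open>j\<close>, so the corner becomes
    \<open>A $$ (0,0) + A $$ (0,j)\<close>, where the first term is zero.\<close>
  let ?B = "add_col_sub_row 1 j 0 A"
  have "similar_mat ?B A"
    by (rule add_col_sub_row_similar[OF A j(1) zero_less_Suc j0])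
  moreover have "?B $$ (0,0) \<noteq> 0"
    using A j j0 True by (subst add_col_sub_index_row) auto
  moreover have "?B \<in> carrier_mat (Suc n) (Suc n)"
    by (rule add_col_sub_row_carrier(3)[OF A])
  ultimately show ?thesis using similar_mat_sym by blast
qed

lemma split_char_poly_upper_block:
  assumes A: "A \<in> carrier_mat 1 1" and B: "B \<in> carrier_mat 1 n" and D: "D \<in> carrier_mat n n"
    and split: "split_char_poly D"
  shows "split_char_poly (four_block_mat A B (0\<^sub>m n 1) D)"
proof -
  obtain as where as: "char_poly D = (\<Prod>a\<leftarrow>as. [:- a, 1:])"
    using split unfolding split_char_poly_def by blast
  have "char_poly A = [:- (A $$ (0,0)), 1:]"
    using A by (auto simp: char_poly_defs det_single)
  then have "char_poly (four_block_mat A B (0\<^sub>m n 1) D) = (\<Prod>a\<leftarrow>A $$ (0,0) # as. [:- a, 1:])"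
    unfolding char_poly_four_block_zeros_col[OF A B D] as by simp
  then show ?thesis unfolding split_char_poly_def by blast
qed

text \<open>Transposition reduces this to the upper block case and preserves the characteristic
  polynomial.\<close>

lemma split_char_poly_lower_block:
  assumes A: "A \<in> carrier_mat 1 1" and C: "C \<in> carrier_mat n 1" and D: "D \<in> carrier_mat n n"
    and split: "split_char_poly D"
  shows "split_char_poly (four_block_mat A (0\<^sub>m 1 n) C D)"
proof -
  let ?M = "four_block_mat A (0\<^sub>m 1 n) C D"
  have M: "?M \<in> carrier_mat (1 + n) (1 + n)" using A D by (rule four_block_carrier_mat)
  have "split_char_poly (four_block_mat (transpose_mat A) (transpose_mat C) (0\<^sub>m n 1) (transpose_mat D))"
    by (rule split_char_poly_upper_block) (use A C D split in \<open>auto simp: split_char_poly_def\<close>)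
  then have "split_char_poly (transpose_mat ?M)"
    using transpose_four_block_mat[OF A zero_carrier_mat C D] by simp
  then show ?thesis using char_poly_transpose_mat[OF M] by (simp add: split_char_poly_def)
qed

text \<open>Inserting \<open>Q * P = 1\<close> between the factors conjugates both of them by the
  same matrix.\<close>

lemma similar_mat_product:
  assumes "similar_mat A (X * Y)" and X: "X \<in> carrier_mat n n" and Y: "Y \<in> carrier_mat n n"
  shows "\<exists>X' Y'. X' \<in> carrier_mat n n \<and> Y' \<in> carrier_mat n n \<and>
           similar_mat X' X \<and> similar_mat Y' Y \<and> A = X' * Y'"
proof -
  obtain m P Q where c: "{A, X * Y, P, Q} \<subseteq> carrier_mat m m" and PQ: "P * Q = 1\<^sub>m m" "Q * P = 1\<^sub>m m"
    and A: "A = P * (X * Y) * Q"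
    using similar_matD[OF assms(1)] by blast
  have "m = n" using c X Y by auto
  with c PQ A have P: "P \<in> carrier_mat n n" and Q: "Q \<in> carrier_mat n n"
    and PQ: "P * Q = 1\<^sub>m n" "Q * P = 1\<^sub>m n" by auto
  note [simp] = assoc_mult_mat[of _ n n _ n _ n]
  have s: "similar_mat (P * Z * Q) Z" if "Z \<in> carrier_mat n n" for Z
    by (rule similar_matI[OF _ PQ]) (use P Q that in auto)
  have "(P * X * Q) * (P * Y * Q) = P * (X * ((Q * P) * (Y * Q)))"
    using P Q X Y by (simp del: PQ)
  also have "\<dots> = P * (X * Y) * Q" using P Q X Y PQ by simp
  finally show ?thesis using s[OF X] s[OF Y] A P Q X Y by (metis mult_carrier_mat)
qed

text \<open>After conjugation to a nonzero pivot, block elimination writes the matrix as lower times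
  upper block triangular. The Schur complement is factored recursively and its two factors become
  the trailing diagonal blocks, so each triangular matrix gains just one real eigenvalue.\<close>

lemma split_char_poly_factorization:
  assumes "A \<in> carrier_mat n n" and "det A \<noteq> 0"
  shows "\<exists>X Y. X \<in> carrier_mat n n \<and> Y \<in> carrier_mat n n \<and> A = X * Y
           \<and> split_char_poly X \<and> split_char_poly Y"
  using assms
proof (induction n arbitrary: A)
  case 0
  have "char_poly A = (\<Prod>a\<leftarrow>[]. [:- a, 1:])"
    using degree_monic_char_poly[OF 0(1)] by (auto elim: degree_eq_zeroE)
  then have "split_char_poly A" unfolding split_char_poly_def by blast
  moreover have "A = A * A" using 0 by (intro eq_matI) auto
  ultimately show ?case using 0 by blast
next
  case (Suc n)
  obtain B where sim: "similar_mat A B" and B: "B \<in> carrier_mat (Suc n) (Suc n)"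
    and piv: "B $$ (0,0) \<noteq> 0"
    using similar_nonzero_pivot[OF Suc.prems] by blast
  obtain a r c D where spl: "split_block B 1 1 = (a, r, c, D)" by (cases "split_block B 1 1") auto
  note blk = split_block[OF spl, of n n]
  have a: "a \<in> carrier_mat 1 1" and r: "r \<in> carrier_mat 1 n" and c: "c \<in> carrier_mat n 1"
    and D: "D \<in> carrier_mat n n" and Beq: "B = four_block_mat a r c D"
    using blk B by auto
  let ?p = "a $$ (0,0)"
  have p: "?p \<noteq> 0" using piv a by (simp add: Beq)
  \<comment> \<open>This is \<open>c\<close> times the inverse of the 1 by 1 block
    \<open>a\<close>.\<close>
  define c' where "c' = (1 / ?p) \<cdot>\<^sub>m c"
  have cc: "c' \<in> carrier_mat n 1" using c by (simp add: c'_def)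
  have ca: "c' * a = c"
  proof (rule eq_matI)
    fix i j assume ij: "i < dim_row c" "j < dim_col c"
    then have "j = 0" "i < n" using c by auto
    then show "(c' * a) $$ (i,j) = c $$ (i,j)"
      using c a p by (simp add: c'_def scalar_prod_def)
  qed (use cc a c in auto)
  \<comment> \<open>The Schur complement of \<open>a\<close> in \<open>B\<close>.\<close>
  define S where "S = D - c' * r"
  have S: "S \<in> carrier_mat n n" unfolding S_def
    by (rule minus_carrier_mat[OF mult_carrier_mat[OF cc r]])
  \<comment> \<open>Stated for any factorization of \<open>S\<close>: the trivial one
    \<open>1 * S\<close> gives the determinant, the inductive one gives the result.\<close>
  have fact: "four_block_mat (1\<^sub>m 1) (0\<^sub>m 1 n) c' X * four_block_mat a r (0\<^sub>m n 1) Y = B"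
    if X: "X \<in> carrier_mat n n" and Y: "Y \<in> carrier_mat n n" and XY: "X * Y = S" for X Y
  proof -
    have cr: "c' * r \<in> carrier_mat n n" using cc r by (rule mult_carrier_mat)
    have "Z + (D - Z) = D" if "Z \<in> carrier_mat n n" for Z
      using that D by (intro eq_matI) auto
    from this[OF cr] have "c' * r + X * Y = D" unfolding XY S_def .
    moreover have "1\<^sub>m 1 * a + 0\<^sub>m 1 n * 0\<^sub>m n 1 = a" "1\<^sub>m 1 * r + 0\<^sub>m 1 n * Y = r"
      "c' * a + X * 0\<^sub>m n 1 = c"
      using a r c X Y by (simp_all add: ca del: One_nat_def)
    ultimately show ?thesis unfolding Beq
      unfolding mult_four_block_mat[OF one_carrier_mat zero_carrier_mat cc X a r zero_carrier_mat Y] by metis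
  qed
  have lower: "four_block_mat (1\<^sub>m 1) (0\<^sub>m 1 n) c' X \<in> carrier_mat (Suc n) (Suc n)"
    and upper: "four_block_mat a r (0\<^sub>m n 1) X \<in> carrier_mat (Suc n) (Suc n)"
    if "X \<in> carrier_mat n n" for X
    using four_block_carrier_mat[OF one_carrier_mat that, of 1] four_block_carrier_mat[OF a that]
    by (simp_all del: four_block_carrier_mat)
  have "det B \<noteq> 0" using det_similar[OF sim] Suc.prems by simp
  moreover have "det B = det (four_block_mat (1\<^sub>m 1) (0\<^sub>m 1 n) c' (1\<^sub>m n)) * (det a * det S)"
    unfolding fact[OF one_carrier_mat S left_mult_one_mat[OF S], symmetric]
      det_mult[OF lower[OF one_carrier_mat] upper[OF S]]
      det_four_block_mat_lower_left_zero_col[OF a r refl S] ..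
  ultimately have "det S \<noteq> 0" by auto
  with Suc.IH[OF S] obtain X Y where X: "X \<in> carrier_mat n n" and Y: "Y \<in> carrier_mat n n"
    and XY: "S = X * Y" and spl: "split_char_poly X" "split_char_poly Y" by blast
  let ?X = "four_block_mat (1\<^sub>m 1) (0\<^sub>m 1 n) c' X" and ?Y = "four_block_mat a r (0\<^sub>m n 1) Y"
  have "similar_mat A (?X * ?Y)" using sim fact[OF X Y XY[symmetric]] by simp
  then obtain X' Y' where cX: "X' \<in> carrier_mat (Suc n) (Suc n)" and cY: "Y' \<in> carrier_mat (Suc n) (Suc n)"
    and sX: "similar_mat X' ?X" and sY: "similar_mat Y' ?Y" and A': "A = X' * Y'"
    using similar_mat_product[OF _ lower[OF X] upper[OF Y]] by blast
  have "split_char_poly X'" "split_char_poly Y'"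
    using split_char_poly_lower_block[OF one_carrier_mat cc X spl(1)]
      split_char_poly_upper_block[OF a r Y spl(2)]
      char_poly_similar[OF sX] char_poly_similar[OF sY] by (simp_all add: split_char_poly_def)
  with A' cX cY show ?case by blast
qed

section \<open>Matrices that differ from the identity by a product of two symmetric matrices\<close>

text \<open>The leading block of the product of an upper factor \<open>S\<close> and a lower factor \<open>T\<close> is \<open>1 + S T\<close>.\<close>

definition symmetric_pair :: "nat \<Rightarrow> real mat \<Rightarrow> bool" where
  "symmetric_pair n X \<longleftrightarrow> (\<exists>S\<in>symmetric_mats n. \<exists>T\<in>symmetric_mats n. X = 1\<^sub>m n + S * T)"

text \<open>\<open>?T\<close> is the reversal permutation. Reversing the columns of the block minus
  the identity gives \<open>?S\<close>, whose entries depend only on \<open>i + j\<close>; such a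
  Hankel matrix is symmetric.\<close>

lemma symmetric_pair_jordan_block: "symmetric_pair n (jordan_block n a)"
proof -
  let ?S = "mat n n (\<lambda>(i,j). if i + j + 1 = n then a - 1 else if i + j + 2 = n then 1 else 0)"
  let ?T = "mat n n (\<lambda>(i,j). if i + j + 1 = n then 1 else 0 :: real)"
  have "?S \<in> symmetric_mats n" "?T \<in> symmetric_mats n"
    by (auto simp: symmetric_mats_def add.commute intro!: eq_matI)
  moreover have "jordan_block n a = 1\<^sub>m n + ?S * ?T"
  proof (rule eq_matI)
    fix i j assume "i < dim_row (1\<^sub>m n + ?S * ?T)" "j < dim_col (1\<^sub>m n + ?S * ?T)"
    then have i: "i < n" and j: "j < n" by auto
    have "(?S * ?T) $$ (i,j) = (\<Sum>k = 0..<n. ?S $$ (i,k) * ?T $$ (k,j))"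
      using i j by (simp add: scalar_prod_def)
    also have "\<dots> = (\<Sum>k = 0..<n. if k = n - 1 - j then ?S $$ (i,k) else 0)"
      by (rule sum.cong) (use j in auto)
    also have "\<dots> = ?S $$ (i, n - 1 - j)"
      using j by simp
    also have "\<dots> = (if i = j then a - 1 else if Suc i = j then 1 else 0)"
      using i j by auto
    finally show "jordan_block n a $$ (i,j) = (1\<^sub>m n + ?S * ?T) $$ (i,j)"
      using i j by simp
  qed auto
  ultimately show ?thesis unfolding symmetric_pair_def by blast
qed

lemma symmetric_pair_block_diag:
  assumes "symmetric_pair m X" and "symmetric_pair n Y"
  shows "symmetric_pair (m + n) (four_block_mat X (0\<^sub>m m n) (0\<^sub>m n m) Y)"
proof -
  obtain S T S' T' where S: "S \<in> carrier_mat m m" "transpose_mat S = S"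
    and T: "T \<in> carrier_mat m m" "transpose_mat T = T"
    and S': "S' \<in> carrier_mat n n" "transpose_mat S' = S'"
    and T': "T' \<in> carrier_mat n n" "transpose_mat T' = T'"
    and X: "X = 1\<^sub>m m + S * T" and Y: "Y = 1\<^sub>m n + S' * T'"
    using assms unfolding symmetric_pair_def symmetric_mats_def by blast
  let ?D = "\<lambda>A B. four_block_mat A (0\<^sub>m m n) (0\<^sub>m n m) B"
  have "?D S S' * ?D T T' = ?D (S * T) (S' * T')"
    using S T S' T' by (subst mult_four_block_mat[OF S(1) _ _ S'(1) T(1) _ _ T'(1)]) auto
  then have "1\<^sub>m (m + n) + ?D S S' * ?D T T' = ?D X Y"
    unfolding X Y four_block_one_mat[symmetric]
    using S T S' T' by (simp add: add_four_block_mat[of _ m m _ n _ n] del: four_block_one_mat)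
  moreover have "?D S S' \<in> symmetric_mats (m + n)" "?D T T' \<in> symmetric_mats (m + n)"
    using S S' T T' by (auto intro!: symmetric_matsI
      simp: transpose_four_block_mat[of _ m m _ n _ n])
  ultimately show ?thesis unfolding symmetric_pair_def by metis
qed

lemma symmetric_pair_jordan_matrix: "symmetric_pair (sum_list (map fst n_as)) (jordan_matrix n_as)"
proof (induction n_as)
  case Nil
  have z: "0\<^sub>m 0 0 \<in> symmetric_mats 0" by (simp add: symmetric_mats_def)
  have "jordan_matrix [] = (1\<^sub>m 0 + 0\<^sub>m 0 0 * 0\<^sub>m 0 0 :: real mat)"
    by (intro eq_matI) (auto simp: jordan_matrix_def)
  then show ?case unfolding symmetric_pair_def using z by (auto intro!: bexI[OF _ z])
next
  case (Cons na n_as)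
  then show ?case
    using symmetric_pair_block_diag[OF symmetric_pair_jordan_block]
    by (cases na) (simp add: jordan_matrix_Cons)
qed

lemma symmetric_congruence:
  assumes S: "S \<in> symmetric_mats n" and P: "P \<in> carrier_mat n n"
  shows "P * S * transpose_mat P \<in> symmetric_mats n"
proof (rule symmetric_matsI)
  have S: "S \<in> carrier_mat n n" "transpose_mat S = S" using S by (auto simp: symmetric_mats_def)
  show "P * S * transpose_mat P \<in> carrier_mat n n" using P S by auto
  show "transpose_mat (P * S * transpose_mat P) = P * S * transpose_mat P"
    using P S by (simp add: transpose_mult[of _ n n _ n] assoc_mult_mat[of _ n n _ n _ n])
qed

text \<open>If \<open>Q\<close> is the inverse of \<open>P\<close>, then \<open>P S T Q = (P S P\<^sup>T) (Q\<^sup>T T Q)\<close>.\<close>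

lemma symmetric_pair_similar:
  assumes "similar_mat A B" and "symmetric_pair n B"
  shows "symmetric_pair n A"
proof -
  obtain S T where S: "S \<in> symmetric_mats n" and T: "T \<in> symmetric_mats n"
    and B: "B = 1\<^sub>m n + S * T"
    using assms(2) unfolding symmetric_pair_def by blast
  have Sc: "S \<in> carrier_mat n n" and Tc: "T \<in> carrier_mat n n"
    using S T by (auto simp: symmetric_mats_def)
  obtain m P Q where c: "{A, B, P, Q} \<subseteq> carrier_mat m m" and PQ: "P * Q = 1\<^sub>m m" "Q * P = 1\<^sub>m m"
    and A: "A = P * B * Q"
    using similar_matD[OF assms(1)] by blast
  have "m = n" using c B Sc Tc by auto
  with c PQ have P: "P \<in> carrier_mat n n" and Q: "Q \<in> carrier_mat n n"
    and PQ: "P * Q = 1\<^sub>m n" "Q * P = 1\<^sub>m n" by auto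
  have Pt: "transpose_mat P \<in> carrier_mat n n" and Qt: "transpose_mat Q \<in> carrier_mat n n"
    using P Q by auto
  have t: "transpose_mat P * transpose_mat Q = 1\<^sub>m n"
    using transpose_mult[OF Q P] PQ by simp
  note asc = assoc_mult_mat[of _ n n _ n _ n]
  have "(P * S * transpose_mat P) * (transpose_mat Q * T * Q)
      = P * (S * ((transpose_mat P * transpose_mat Q) * (T * Q)))"
    using P Q Pt Qt Sc Tc by (simp add: asc)
  also have "\<dots> = P * (S * T) * Q"
    unfolding t using P Q Sc Tc by (simp add: asc)
  finally have "A = 1\<^sub>m n + (P * S * transpose_mat P) * (transpose_mat Q * T * Q)"
    unfolding A B using P Q Sc Tc PQ
    by (simp add: mult_add_distrib_mat[of _ n n _ n] add_mult_distrib_mat[of _ n n _ _ n])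
  moreover have "P * S * transpose_mat P \<in> symmetric_mats n"
    by (rule symmetric_congruence[OF S P])
  moreover have "transpose_mat Q * T * Q \<in> symmetric_mats n"
    using symmetric_congruence[OF T Qt] by simp
  ultimately show ?thesis unfolding symmetric_pair_def by blast
qed

lemma symmetric_pair_if_split_char_poly:
  assumes A: "A \<in> carrier_mat n n" and "split_char_poly A"
  shows "symmetric_pair n A"
proof -
  obtain n_as where sim: "similar_mat A (jordan_matrix n_as)"
    using jordan_nf_exists[OF A] assms(2) unfolding split_char_poly_def jordan_nf_def by blast
  obtain m where "A \<in> carrier_mat m m" "jordan_matrix n_as \<in> carrier_mat m m"
    using similar_matD[OF sim] by blast
  then have "sum_list (map fst n_as) = n"
    using A jordan_matrix_dim(1)[of n_as] by (metis carrier_matD(1))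
  then show ?thesis
    using symmetric_pair_similar[OF sim] symmetric_pair_jordan_matrix[of n_as] by simp
qed

section \<open>Symplectic matrices in block form\<close>

lemma four_block_mat_inject:
  assumes "A \<in> carrier_mat m k" "B \<in> carrier_mat m l" "C \<in> carrier_mat n k" "D \<in> carrier_mat n l"
    and "A' \<in> carrier_mat m k" "B' \<in> carrier_mat m l" "C' \<in> carrier_mat n k" "D' \<in> carrier_mat n l"
    and eq: "four_block_mat A B C D = four_block_mat A' B' C' D'"
  shows "A = A'" "B = B'" "C = C'" "D = D'"
proof -
  have ix: "four_block_mat A B C D $$ (i,j) = four_block_mat A' B' C' D' $$ (i,j)" for i j
    using eq by simp
  show "A = A'"
  proof (rule eq_matI)
    fix i j assume "i < dim_row A'" "j < dim_col A'"
    then show "A $$ (i,j) = A' $$ (i,j)" using ix[of i j] assms(1-8) by simp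
  qed (use assms in auto)
  show "B = B'"
  proof (rule eq_matI)
    fix i j assume "i < dim_row B'" "j < dim_col B'"
    then show "B $$ (i,j) = B' $$ (i,j)" using ix[of i "j + k"] assms(1-8) by simp
  qed (use assms in auto)
  show "C = C'"
  proof (rule eq_matI)
    fix i j assume "i < dim_row C'" "j < dim_col C'"
    then show "C $$ (i,j) = C' $$ (i,j)" using ix[of "i + m" j] assms(1-8) by simp
  qed (use assms in auto)
  show "D = D'"
  proof (rule eq_matI)
    fix i j assume "i < dim_row D'" "j < dim_col D'"
    then show "D $$ (i,j) = D' $$ (i,j)" using ix[of "i + m" "j + k"] assms(1-8) by simp
  qed (use assms in auto)
qed

lemma symplectic_form_four_block:
  assumes A: "A \<in> carrier_mat d d" and B: "B \<in> carrier_mat d d"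
    and C: "C \<in> carrier_mat d d" and D: "D \<in> carrier_mat d d"
  shows "transpose_mat (four_block_mat A B C D) * J_mat d * four_block_mat A B C D =
    four_block_mat (transpose_mat A * C - transpose_mat C * A) (transpose_mat A * D - transpose_mat C * B)
      (transpose_mat B * C - transpose_mat D * A) (transpose_mat B * D - transpose_mat D * B)"
proof -
  have t: "X\<^sup>T * 0\<^sub>m d d + Y\<^sup>T * - 1\<^sub>m d = - Y\<^sup>T" "X\<^sup>T * 1\<^sub>m d + Y\<^sup>T * 0\<^sub>m d d = X\<^sup>T"
    if "X \<in> carrier_mat d d" "Y \<in> carrier_mat d d" for X Y :: "real mat"
    using that by auto
  have m: "- Z + W = W - Z" if "Z \<in> carrier_mat d d" "W \<in> carrier_mat d d" for Z W :: "real mat"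
    using that by (intro eq_matI) auto
  have "transpose_mat (four_block_mat A B C D) * J_mat d = four_block_mat (- C\<^sup>T) (A\<^sup>T) (- D\<^sup>T) (B\<^sup>T)"
    unfolding transpose_four_block_mat[OF A B C D] J_mat_def
    using A B C D by (subst mult_four_block_mat[of _ d d _ d _ d _ _ d _ d]) (auto simp: t)
  then show ?thesis
    using A B C D by (simp add: mult_four_block_mat[of _ d d _ d _ d _ _ d _ d] m)
qed

text \<open>Compare the blocks of \<open>symplectic_form_four_block\<close> with those of
  \<open>J_mat d\<close>. The second and third conditions are transposes of each other; the former
  yields the block factorization, the latter the trivial common kernel of \<open>A\<close> and
  \<open>C\<close>.\<close>

lemma four_block_mem_SP_iff:
  assumes A: "A \<in> carrier_mat d d" and B: "B \<in> carrier_mat d d"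
    and C: "C \<in> carrier_mat d d" and D: "D \<in> carrier_mat d d"
  shows "four_block_mat A B C D \<in> SP d \<longleftrightarrow>
    A\<^sup>T * C = C\<^sup>T * A \<and> A\<^sup>T * D = 1\<^sub>m d + C\<^sup>T * B \<and> D\<^sup>T * A = 1\<^sub>m d + B\<^sup>T * C \<and> B\<^sup>T * D = D\<^sup>T * B"
    (is "?M \<in> _ \<longleftrightarrow> ?R")
proof -
  have diff: "X - Y = 0\<^sub>m d d \<longleftrightarrow> X = Y" "X - Y = 1\<^sub>m d \<longleftrightarrow> X = 1\<^sub>m d + Y" "X - Y = - 1\<^sub>m d \<longleftrightarrow> Y = 1\<^sub>m d + X"
    if "X \<in> carrier_mat d d" "Y \<in> carrier_mat d d" for X Y :: "real mat"
    using that by (auto simp: mat_eq_iff algebra_simps) 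
  have M: "?M \<in> carrier_mat (2 * d) (2 * d)"
    using four_block_carrier_mat[OF A D] by (simp add: mult_2)
  have "?M \<in> SP d \<longleftrightarrow> A\<^sup>T * C - C\<^sup>T * A = 0\<^sub>m d d \<and> A\<^sup>T * D - C\<^sup>T * B = 1\<^sub>m d \<and>
      B\<^sup>T * C - D\<^sup>T * A = - 1\<^sub>m d \<and> B\<^sup>T * D - D\<^sup>T * B = 0\<^sub>m d d" (is "_ \<longleftrightarrow> ?Q")
  proof
    assume "?M \<in> SP d"
    then have "four_block_mat (A\<^sup>T * C - C\<^sup>T * A) (A\<^sup>T * D - C\<^sup>T * B) (B\<^sup>T * C - D\<^sup>T * A) (B\<^sup>T * D - D\<^sup>T * B)
        = four_block_mat (0\<^sub>m d d) (1\<^sub>m d) (- 1\<^sub>m d) (0\<^sub>m d d)"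
      unfolding SP_def symplectic_form_four_block[OF A B C D, symmetric] by (simp add: J_mat_def)
    note inj = four_block_mat_inject[OF _ _ _ _ _ _ _ _ this, of d d d d]
    show ?Q using A B C D by (intro conjI; intro inj) auto
  next
    assume ?Q
    then show "?M \<in> SP d"
      using M unfolding SP_def mem_Collect_eq symplectic_form_four_block[OF A B C D] by (simp add: J_mat_def)
  qed
  also have "\<dots> \<longleftrightarrow> ?R"
    using A B C D by (simp add: diff)
  finally show ?thesis .
qed

section \<open>Alternating products are symplectic\<close>

lemma unit_upper_mem_SP: "S \<in> symmetric_mats d \<Longrightarrow> unit_upper d S \<in> SP d"
  unfolding unit_upper_def symmetric_mats_def by (subst four_block_mem_SP_iff) auto

lemma unit_lower_mem_SP: "S \<in> symmetric_mats d \<Longrightarrow> unit_lower d S \<in> SP d"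
  unfolding unit_lower_def symmetric_mats_def by (subst four_block_mem_SP_iff) auto

lemma J_mat_carrier: "J_mat d \<in> carrier_mat (2 * d) (2 * d)"
  unfolding J_mat_def using four_block_carrier_mat[of "0\<^sub>m d d" d d "0\<^sub>m d d" d d] by (simp add: mult_2)

lemma SP_mult:
  assumes "G \<in> SP d" and "H \<in> SP d"
  shows "G * H \<in> SP d"
proof -
  have G: "G \<in> carrier_mat (2 * d) (2 * d)" "G\<^sup>T * J_mat d * G = J_mat d"
    and H: "H \<in> carrier_mat (2 * d) (2 * d)" "H\<^sup>T * J_mat d * H = J_mat d"
    using assms by (auto simp: SP_def)
  have t: "G\<^sup>T \<in> carrier_mat (2 * d) (2 * d)" "H\<^sup>T \<in> carrier_mat (2 * d) (2 * d)"
    using G H by auto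
  have "(G * H)\<^sup>T * J_mat d * (G * H) = H\<^sup>T * (G\<^sup>T * J_mat d * G) * H"
    using G(1) H(1) t J_mat_carrier[of d]
    by (simp add: transpose_mult[OF G(1) H(1)]
        assoc_mult_mat[of _ "2 * d" "2 * d" _ "2 * d" _ "2 * d"])
  then show ?thesis using G H by (simp add: SP_def)
qed

lemma one_mem_SP: "1\<^sub>m (2 * d) \<in> SP d"
  using J_mat_carrier[of d] by (simp add: SP_def)

lemma alt_prod_mem_SP:
  assumes "\<forall>i\<in>{1..n}. S i \<in> symmetric_mats d"
  shows "alt_prod d S n \<in> SP d"
  using assms
proof (induction n)
  case 0
  then show ?case by (simp add: one_mem_SP)
next
  case (Suc n)
  then have "S (Suc n) \<in> symmetric_mats d" by simp
  then have "alt_factor d S (Suc n) \<in> SP d"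
    by (simp add: alt_factor_def unit_upper_mem_SP unit_lower_mem_SP)
  with Suc show ?case by (simp add: SP_mult)
qed

lemma alt_prod_numeral:
  "alt_prod d S (numeral k) = alt_factor d S (numeral k) * alt_prod d S (pred_numeral k)"
  by (simp add: numeral_eq_Suc)

text \<open>The list is reversed because the factor of highest index stands leftmost.\<close>

lemma alt_prod_eq_foldr:
  "alt_prod d S n = foldr (*) (map (alt_factor d S) (rev [1..<Suc n])) (1\<^sub>m (2 * d))"
  by (induction n) simp_all

section \<open>Block LDU factorization and words for block diagonal matrices\<close>

lemma obtain_inverse_mat:
  fixes A :: "'a :: field mat"
  assumes "A \<in> carrier_mat n n" and "det A \<noteq> 0"
  obtains B where "B \<in> carrier_mat n n" "A * B = 1\<^sub>m n" "B * A = 1\<^sub>m n"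
  using det_non_zero_imp_unit[OF assms, of "()"] unfolding Units_def ring_mat_def by auto

text \<open>The second argument \<open>A'\<close> is to be the inverse of \<open>A\<close>.\<close>

definition block_diag_symplectic :: "nat \<Rightarrow> real mat \<Rightarrow> real mat \<Rightarrow> real mat" where
  "block_diag_symplectic d A A' = four_block_mat A (0\<^sub>m d d) (0\<^sub>m d d) (A'\<^sup>T)"

lemma block_diag_symplectic_mult:
  assumes "A \<in> carrier_mat d d" "A' \<in> carrier_mat d d" "B \<in> carrier_mat d d" "B' \<in> carrier_mat d d"
  shows "block_diag_symplectic d A A' * block_diag_symplectic d B B' = block_diag_symplectic d (A * B) (B' * A')"
  using assms unfolding block_diag_symplectic_def
  by (simp add: mult_four_block_mat[of _ d d _ d _ d _ _ d _ d] transpose_mult[of _ d d _ d])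

lemma unit_triangular_carrier:
  assumes "S \<in> carrier_mat d d"
  shows "unit_upper d S \<in> carrier_mat (2 * d) (2 * d)" "unit_lower d S \<in> carrier_mat (2 * d) (2 * d)"
  unfolding unit_upper_def unit_lower_def mult_2
  by (rule four_block_carrier_mat; simp)+

lemma block_diag_symplectic_carrier:
  assumes "A \<in> carrier_mat d d" "A' \<in> carrier_mat d d"
  shows "block_diag_symplectic d A A' \<in> carrier_mat (2 * d) (2 * d)"
  unfolding block_diag_symplectic_def mult_2 using assms
  by (intro four_block_carrier_mat) simp_all

lemma unit_upper_add:
  assumes "S \<in> carrier_mat d d" "T \<in> carrier_mat d d"
  shows "unit_upper d S * unit_upper d T = unit_upper d (S + T)"
  using assms comm_add_mat[OF assms] unfolding unit_upper_def
  by (simp add: mult_four_block_mat[of _ d d _ d _ d _ _ d _ d])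

lemma unit_lower_add:
  assumes "S \<in> carrier_mat d d" "T \<in> carrier_mat d d"
  shows "unit_lower d S * unit_lower d T = unit_lower d (S + T)"
  using assms unfolding unit_lower_def
  by (simp add: mult_four_block_mat[of _ d d _ d _ d _ _ d _ d])

lemma unit_upper_zero: "unit_upper d (0\<^sub>m d d) = 1\<^sub>m (2 * d)"
  by (simp add: unit_upper_def mult_2)

lemma unit_lower_zero: "unit_lower d (0\<^sub>m d d) = 1\<^sub>m (2 * d)"
  by (simp add: unit_lower_def mult_2)

text \<open>Block elimination with \<open>p = C * A'\<close> and \<open>q = A' * B\<close>. The
  symplectic relations make both symmetric and force the Schur complement \<open>D - p * B\<close>
  to be the inverse transpose of \<open>A\<close>.\<close>

lemma SP_lower_diag_upper:
  assumes A: "A \<in> carrier_mat d d" and B: "B \<in> carrier_mat d d"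
    and C: "C \<in> carrier_mat d d" and D: "D \<in> carrier_mat d d"
    and sp: "four_block_mat A B C D \<in> SP d"
    and A': "A' \<in> carrier_mat d d" "A * A' = 1\<^sub>m d" "A' * A = 1\<^sub>m d"
  shows "\<exists>p\<in>symmetric_mats d. \<exists>q\<in>symmetric_mats d.
    four_block_mat A B C D = unit_lower d p * (block_diag_symplectic d A A' * unit_upper d q)"
proof -
  note asc = assoc_mult_mat[of _ d d _ d _ d]
  note tm = transpose_mult[of _ d d _ d]
  from sp have AC: "A\<^sup>T * C = C\<^sup>T * A" and AD: "A\<^sup>T * D = 1\<^sub>m d + C\<^sup>T * B" and BD: "B\<^sup>T * D = D\<^sup>T * B"
    unfolding four_block_mem_SP_iff[OF A B C D] by auto
  have At: "A\<^sup>T \<in> carrier_mat d d" and A't: "A'\<^sup>T \<in> carrier_mat d d" and Bt: "B\<^sup>T \<in> carrier_mat d d"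
    and Ct: "C\<^sup>T \<in> carrier_mat d d" and Dt: "D\<^sup>T \<in> carrier_mat d d" 
    using A B C D A' by auto
  have AAt: "A'\<^sup>T * A\<^sup>T = 1\<^sub>m d" using tm[OF A A'(1)] A' by simp
  define p where "p = C * A'"
  define q where "q = A' * B"
  have p: "p \<in> carrier_mat d d" and q: "q \<in> carrier_mat d d" using A' B C by (auto simp: p_def q_def)
  \<comment> \<open>\<open>p\<close> is congruent to the symmetric matrix
    \<open>A\<^sup>T * C\<close>.\<close>
  have "p\<^sup>T = A'\<^sup>T * (C\<^sup>T * A) * A'"
    using A' C A A't Ct by (simp add: p_def tm asc)
  also have "\<dots> = (A'\<^sup>T * A\<^sup>T) * (C * A')"
    unfolding AC[symmetric] using A't At C A' by (simp add: asc)
  finally have pt: "p\<^sup>T = p" using C A' by (simp add: AAt p_def)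
  have "D = A'\<^sup>T * A\<^sup>T * D" using D by (simp add: AAt)
  also have "\<dots> = A'\<^sup>T * (1\<^sub>m d + C\<^sup>T * B)" using D A't At by (simp add: asc AD)
  also have "\<dots> = A'\<^sup>T + A'\<^sup>T * C\<^sup>T * B"
    using A't Ct B by (simp add: mult_add_distrib_mat[of _ d d _ d] asc)
  also have "A'\<^sup>T * C\<^sup>T = p" using tm[OF C A'(1)] pt by (simp add: p_def)
  finally have Deq: "D = A'\<^sup>T + p * B" .
  have Dteq: "D\<^sup>T = A' + B\<^sup>T * p"
    unfolding Deq using A' p B pt by (simp add: tm transpose_add[of _ d d])
  \<comment> \<open>Substitute the formulas for \<open>D\<close> and its transpose into
    \<open>B\<^sup>T * D = D\<^sup>T * B\<close>; cancelling the common summand leaves the symmetry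
    of \<open>q\<close>.\<close>
  have "B\<^sup>T * A'\<^sup>T + B\<^sup>T * p * B = A' * B + B\<^sup>T * p * B"
    using BD unfolding Dteq using Bt A't p B A'(1) unfolding Deq
    by (simp add: mult_add_distrib_mat[of _ d d _ d] add_mult_distrib_mat[of _ d d _ _ d] asc)
  moreover have "X = Y" if "X + Z = Y + Z" "X \<in> carrier_mat d d" "Y \<in> carrier_mat d d" "Z \<in> carrier_mat d d"
    for X Y Z :: "real mat"
    using that by (auto simp: mat_eq_iff)
  ultimately have "B\<^sup>T * A'\<^sup>T = A' * B" using Bt A't p B A'(1) by (metis mult_carrier_mat)
  then have qt: "q\<^sup>T = q" using tm[OF A'(1) B] by (simp add: q_def)
  have "A * q = B" using A A' B by (simp add: q_def asc[symmetric])
  moreover have "p * A = C" using A A' C by (simp add: p_def asc)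
  ultimately have "unit_lower d p * (block_diag_symplectic d A A' * unit_upper d q) = four_block_mat A B C (p * B + A'\<^sup>T)"
    unfolding unit_lower_def unit_upper_def block_diag_symplectic_def
    using A B C A't p q by (simp add: mult_four_block_mat[of _ d d _ d _ d _ _ d _ d])
  also have "p * B + A'\<^sup>T = D" unfolding Deq
    using p B A't comm_add_mat[of "p * B" d d "A'\<^sup>T"] by simp
  finally show ?thesis using symmetric_matsI[OF p pt] symmetric_matsI[OF q qt] by metis
qed

text \<open>The two-factor product \<open>?G\<close> has leading block \<open>X\<close>, so its
  block LDU factorization can be solved for the diagonal part.\<close>

lemma block_diag_symplectic_word:
  assumes "symmetric_pair d X"
    and X: "X \<in> carrier_mat d d" "X' \<in> carrier_mat d d" "X * X' = 1\<^sub>m d" "X' * X = 1\<^sub>m d"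
  shows "\<exists>a\<in>symmetric_mats d. \<exists>S\<in>symmetric_mats d. \<exists>T\<in>symmetric_mats d. \<exists>b\<in>symmetric_mats d.
    block_diag_symplectic d X X' = unit_lower d a * (unit_upper d S * (unit_lower d T * unit_upper d b))"
proof -
  obtain S T where S: "S \<in> symmetric_mats d" and T: "T \<in> symmetric_mats d" and Xeq: "X = 1\<^sub>m d + S * T"
    using assms(1) unfolding symmetric_pair_def by blast
  note Sc = symmetric_matsD(1)[OF S] and Tc = symmetric_matsD(1)[OF T]
  let ?G = "unit_upper d S * unit_lower d T"
  have G: "?G = four_block_mat X S T (1\<^sub>m d)"
    unfolding unit_lower_def unit_upper_def Xeq
    using Sc Tc by (simp add: mult_four_block_mat[of _ d d _ d _ d _ _ d _ d])
  have "?G \<in> SP d"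
    using S T by (intro SP_mult unit_upper_mem_SP unit_lower_mem_SP)
  then obtain p q where p: "p \<in> symmetric_mats d" and q: "q \<in> symmetric_mats d"
    and eq: "?G = unit_lower d p * (block_diag_symplectic d X X' * unit_upper d q)"
    using SP_lower_diag_upper[OF X(1) Sc Tc one_carrier_mat _ X(2-4)] unfolding G by blast
  note pc = symmetric_matsD(1)[OF p] and qc = symmetric_matsD(1)[OF q]
  have mp: "- p \<in> carrier_mat d d" and mq: "- q \<in> carrier_mat d d" using pc qc by auto
  note asc = assoc_mult_mat[of _ "2 * d" "2 * d" _ "2 * d" _ "2 * d"]
  note car = unit_triangular_carrier[OF Sc] unit_triangular_carrier[OF Tc] 
    unit_triangular_carrier[OF pc] unit_triangular_carrier[OF qc]
    unit_triangular_carrier[OF mp] unit_triangular_carrier[OF mq]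
    block_diag_symplectic_carrier[OF X(1,2)]
  have q0: "q + - q = 0\<^sub>m d d" using qc by (intro eq_matI) auto
  \<comment> \<open>Negating the parameter inverts a triangular factor.\<close>
  have "unit_lower d (- p) * (?G * unit_upper d (- q)) =
      (unit_lower d (- p) * unit_lower d p) * (block_diag_symplectic d X X' * (unit_upper d q * unit_upper d (- q)))"
    unfolding eq using car by (simp add: asc)
  also have "\<dots> = block_diag_symplectic d X X'"
    using car pc qc by (simp add: unit_lower_add[OF mp pc] unit_upper_add[OF qc mq]
      unit_lower_zero unit_upper_zero q0)
  finally have "block_diag_symplectic d X X' =
      unit_lower d (- p) * (unit_upper d S * (unit_lower d T * unit_upper d (- q)))"
    using car by (simp add: asc)
  then show ?thesis
    using symmetric_mats_uminus[OF p] symmetric_mats_uminus[OF q] S T by blast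
qed

section \<open>Making the leading block nonsingular by a shift\<close>

text \<open>If every shift were singular, kernel vectors would produce more than \<open>d\<close>
  nonzero, pairwise orthogonal vectors in dimension \<open>d\<close>.\<close>

lemma exists_nonsingular_shift:
  fixes A C :: "real mat"
  assumes A: "A \<in> carrier_mat d d" and C: "C \<in> carrier_mat d d"
    and AC: "A\<^sup>T * C = C\<^sup>T * A"
    and ker: "\<And>v. v \<in> carrier_vec d \<Longrightarrow> A *\<^sub>v v = 0\<^sub>v d \<Longrightarrow> C *\<^sub>v v = 0\<^sub>v d \<Longrightarrow> v = 0\<^sub>v d"
  shows "\<exists>s. det (A + s \<cdot>\<^sub>m C) \<noteq> 0"
proof (rule ccontr)
  assume "\<not> ?thesis"
  then have "\<exists>v. v \<in> carrier_vec d \<and> v \<noteq> 0\<^sub>v d \<and> (A + s \<cdot>\<^sub>m C) *\<^sub>v v = 0\<^sub>v d" for s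
    using det_0_iff_vec_prod_zero_field[of "A + s \<cdot>\<^sub>m C" d] A C by auto
  then obtain v where v: "\<And>s. v s \<in> carrier_vec d" "\<And>s. v s \<noteq> 0\<^sub>v d"
    and z: "\<And>s. (A + s \<cdot>\<^sub>m C) *\<^sub>v v s = 0\<^sub>v d" by metis
  define w where "w s = C *\<^sub>v v s" for s
  have w: "w s \<in> carrier_vec d" for s using C v by (simp add: w_def)
  have Av: "A *\<^sub>v v s = (- s) \<cdot>\<^sub>v w s" for s
  proof (rule eq_vecI)
    fix i assume "i < dim_vec ((- s) \<cdot>\<^sub>v w s)"
    then have i: "i < d" using w[of s] by simp
    have "((A + s \<cdot>\<^sub>m C) *\<^sub>v v s) $ i = 0" using z[of s] i by simp
    moreover have "((A + s \<cdot>\<^sub>m C) *\<^sub>v v s) $ i = (A *\<^sub>v v s) $ i + s * (w s) $ i"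
      using i A C v[of s] unfolding w_def
      by (simp add: scalar_prod_def sum.distrib sum_distrib_left algebra_simps)
    ultimately show "(A *\<^sub>v v s) $ i = ((- s) \<cdot>\<^sub>v w s) $ i" using i w[of s] by simp
  qed (use A w[of s] in auto)
  have ne: "w s \<noteq> 0\<^sub>v d" for s
  proof
    \<comment> \<open>Then \<open>v s\<close> lies in the kernels of both \<open>A\<close> and
      \<open>C\<close>, against \<open>ker\<close>.\<close>
    assume "w s = 0\<^sub>v d"
    moreover from this have "A *\<^sub>v v s = 0\<^sub>v d" unfolding Av by (intro eq_vecI) auto
    ultimately show False using ker[OF v(1)] v(2) by (metis w_def)
  qed
  have sq: "w s \<bullet> w s \<noteq> 0" for s
  proof
    assume "w s \<bullet> w s = 0"
    then have "\<forall>i\<in>{0..<d}. w s $ i * w s $ i = 0"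
      using carrier_vecD[OF w] by (simp add: scalar_prod_def sum_nonneg_eq_0_iff)
    then have "w s = 0\<^sub>v d" using carrier_vecD[OF w] by (intro eq_vecI) auto
    with ne show False by blast
  qed
  have orth: "w s \<bullet> w t = 0" if "s \<noteq> t" for s t
  proof -
    \<comment> \<open>Symmetry of \<open>A\<^sup>T * C\<close> lets \<open>A\<close> pass from
      \<open>v s\<close> to \<open>v t\<close>: one side carries the factor \<open>- s\<close>, the
      other \<open>- t\<close>.\<close>
    have "w t \<bullet> (A *\<^sub>v v s) = (A\<^sup>T *\<^sub>v (C *\<^sub>v v t)) \<bullet> v s"
      using transpose_vec_mult_scalar[OF A v(1) w] by (simp add: w_def)
    also have "A\<^sup>T *\<^sub>v (C *\<^sub>v v t) = C\<^sup>T *\<^sub>v (A *\<^sub>v v t)"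
      unfolding assoc_mult_mat_vec[OF transpose_carrier_mat[THEN iffD2, OF A] C v(1), symmetric]
        assoc_mult_mat_vec[OF transpose_carrier_mat[THEN iffD2, OF C] A v(1), symmetric] AC ..
    also have "\<dots> \<bullet> v s = (A *\<^sub>v v t) \<bullet> w s"
      using transpose_vec_mult_scalar[OF C v(1) mult_mat_vec_carrier[OF A v(1)]] by (simp add: w_def)
    finally have "s * (w s \<bullet> w t) = t * (w s \<bullet> w t)"
      using w[of s] w[of t] by (simp add: Av comm_scalar_prod[OF w w, of t s])
    with that show ?thesis by simp
  qed
  \<comment> \<open>\<open>d + 1\<close> of the vectors as rows, padded by a zero column: \<open>W W\<^sup>T\<close> is a nonsingular diagonal matrix.\<close>
  define W where "W = mat (Suc d) (Suc d) (\<lambda>(i,k). if k < d then w (real i) $ k else 0)"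
  have W: "W \<in> carrier_mat (Suc d) (Suc d)" by (simp add: W_def)
  have WW: "(W * W\<^sup>T) $$ (i,j) = w (real i) \<bullet> w (real j)" if "i < Suc d" "j < Suc d" for i j
  proof -
    have "(W * W\<^sup>T) $$ (i,j) = (\<Sum>k = 0..<Suc d. W $$ (i,k) * W $$ (j,k))"
      using that W by (simp add: scalar_prod_def)
    also have "\<dots> = (\<Sum>k = 0..<d. w (real i) $ k * w (real j) $ k)"
      using that by (simp add: W_def)
    finally show ?thesis using carrier_vecD[OF w] by (simp add: scalar_prod_def)
  qed
  have WWc: "W * W\<^sup>T \<in> carrier_mat (Suc d) (Suc d)" using W by simp
  have ut: "upper_triangular (W * W\<^sup>T)"
    using W WW orth by (intro upper_triangularI) auto
  have "det (W * W\<^sup>T) = (\<Prod>i = 0..<Suc d. w (real i) \<bullet> w (real i))"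
    unfolding det_upper_triangular[OF ut WWc] prod_list_diag_prod
    using W WW by (intro prod.cong) auto
  also have "\<dots> \<noteq> 0" using sq by simp
  finally have "det W \<noteq> 0" using W by (simp add: det_mult[of W "Suc d"])
  \<comment> \<open>The padding column puts the last unit vector into the kernel of
    \<open>W\<close>.\<close>
  moreover have "W *\<^sub>v unit_vec (Suc d) d = 0\<^sub>v (Suc d)"
    using W by (intro eq_vecI) (auto simp: W_def)
  then have "det W = 0"
    unfolding det_0_iff_vec_prod_zero_field[OF W]
    by (intro exI[of _ "unit_vec (Suc d) d"]) (auto simp: unit_vec_def vec_eq_iff)
  ultimately show False by simp
qed

section \<open>Assembly of the nine factors\<close>

lemma symmetric_pair_factorization:
  assumes "A \<in> carrier_mat n n" and "det A \<noteq> 0"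
  shows "\<exists>X Y. X \<in> carrier_mat n n \<and> Y \<in> carrier_mat n n \<and> A = X * Y
           \<and> symmetric_pair n X \<and> symmetric_pair n Y"
  using split_char_poly_factorization[OF assms] symmetric_pair_if_split_char_poly by blast

lemma SP_obtain_blocks:
  assumes "H \<in> SP d"
  obtains A B C D where "A \<in> carrier_mat d d" "B \<in> carrier_mat d d" "C \<in> carrier_mat d d"
    "D \<in> carrier_mat d d" "H = four_block_mat A B C D"
proof -
  obtain A B C D where "split_block H d d = (A, B, C, D)" by (cases "split_block H d d") auto
  moreover have "dim_row H = d + d" "dim_col H = d + d" using assms by (auto simp: SP_def)
  ultimately show ?thesis using split_block[of H d d A B C D d d] that by blast
qed

text \<open>A vector killed by \<open>A\<close> and \<open>C\<close> is killed by
  \<open>D\<^sup>T * A - B\<^sup>T * C\<close>, which is the identity.\<close>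

lemma SP_exists_nonsingular_shift:
  assumes A: "A \<in> carrier_mat d d" and B: "B \<in> carrier_mat d d"
    and C: "C \<in> carrier_mat d d" and D: "D \<in> carrier_mat d d"
    and sp: "four_block_mat A B C D \<in> SP d"
  shows "\<exists>s. det (A + s \<cdot>\<^sub>m C) \<noteq> 0"
proof (rule exists_nonsingular_shift[OF A C])
  from sp have AC: "A\<^sup>T * C = C\<^sup>T * A" and DA: "D\<^sup>T * A = 1\<^sub>m d + B\<^sup>T * C"
    unfolding four_block_mem_SP_iff[OF A B C D] by auto
  show "A\<^sup>T * C = C\<^sup>T * A" by (rule AC)
  fix v :: "real vec"
  assume v: "v \<in> carrier_vec d" and Av: "A *\<^sub>v v = 0\<^sub>v d" and Cv: "C *\<^sub>v v = 0\<^sub>v d"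
  have zero: "X *\<^sub>v 0\<^sub>v d = 0\<^sub>v d" if "X \<in> carrier_mat d d" for X :: "real mat"
    using that by (intro eq_vecI) auto
  have "0\<^sub>v d = (D\<^sup>T * A) *\<^sub>v v"
    using assoc_mult_mat_vec[of "D\<^sup>T" d d A d v] A D v Av zero[of "D\<^sup>T"] by simp
  also have "\<dots> = v + (B\<^sup>T * C) *\<^sub>v v"
    unfolding DA using add_mult_distrib_mat_vec[of "1\<^sub>m d" d d "B\<^sup>T * C" v] B C v by simp
  also have "(B\<^sup>T * C) *\<^sub>v v = 0\<^sub>v d"
    using assoc_mult_mat_vec[of "B\<^sup>T" d d C d v] B C v Cv zero[of "B\<^sup>T"] by simp
  finally show "v = 0\<^sub>v d" using v by simp
qed

text \<open>One factor undoes the shift, \<open>p\<close> and \<open>q\<close> come from the LDU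
  factorization, and each of \<open>X\<close>, \<open>Y\<close> costs four. Of these eleven,
  \<open>p\<close> merges with \<open>a1\<close> and \<open>b2\<close> with \<open>q\<close>; the
  rest already alternates.\<close>

lemma SP_word:
  assumes H: "H \<in> SP d"
  shows "\<exists>S. (\<forall>i. S i \<in> symmetric_mats d) \<and> H = alt_prod d S 9"
proof -
  obtain A B C D where A: "A \<in> carrier_mat d d" and B: "B \<in> carrier_mat d d"
    and C: "C \<in> carrier_mat d d" and D: "D \<in> carrier_mat d d" and Heq: "H = four_block_mat A B C D"
    using SP_obtain_blocks[OF H] by blast
  obtain s where s: "det (A + s \<cdot>\<^sub>m C) \<noteq> 0"
    using SP_exists_nonsingular_shift[OF A B C D] H Heq by blast
  let ?A = "A + s \<cdot>\<^sub>m C" and ?B = "B + s \<cdot>\<^sub>m D"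
  define r where "r = s \<cdot>\<^sub>m (1\<^sub>m d :: real mat)"
  have r: "r \<in> symmetric_mats d" unfolding r_def by (rule symmetric_mats_smult_one)
  have rc: "r \<in> carrier_mat d d" and mrc: "- r \<in> carrier_mat d d" using symmetric_matsD(1)[OF r] by auto
  have Ac: "?A \<in> carrier_mat d d" and Bc: "?B \<in> carrier_mat d d" using A B C D by auto
  have H': "unit_upper d r * H = four_block_mat ?A ?B C D"
    unfolding Heq unit_upper_def r_def
    using A B C D by (simp add: mult_four_block_mat[of _ d d _ d _ d _ _ d _ d] mult_smult_assoc_mat[of _ d d _ d])
  then have sp: "four_block_mat ?A ?B C D \<in> SP d"
    using SP_mult[OF unit_upper_mem_SP[OF r] H] by simp
  obtain X Y where X: "X \<in> carrier_mat d d" and Y: "Y \<in> carrier_mat d d" and XY: "?A = X * Y"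
    and pair: "symmetric_pair d X" "symmetric_pair d Y"
    using symmetric_pair_factorization[OF Ac s] by blast
  have "det X \<noteq> 0" "det Y \<noteq> 0" using s det_mult[OF X Y] by (auto simp: XY)
  obtain X' where X': "X' \<in> carrier_mat d d" "X * X' = 1\<^sub>m d" "X' * X = 1\<^sub>m d"
    using obtain_inverse_mat[OF X \<open>det X \<noteq> 0\<close>] .
  obtain Y' where Y': "Y' \<in> carrier_mat d d" "Y * Y' = 1\<^sub>m d" "Y' * Y = 1\<^sub>m d"
    using obtain_inverse_mat[OF Y \<open>det Y \<noteq> 0\<close>] .
  note asd = assoc_mult_mat[of _ d d _ d _ d]
  \<comment> \<open>\<open>Y' * X'\<close> is the second argument that
    \<open>block_diag_symplectic_mult\<close> produces.\<close>
  have "(X * Y) * (Y' * X') = X * ((Y * Y') * X')" using X Y X'(1) Y'(1) by (simp add: asd)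
  then have inv1: "?A * (Y' * X') = 1\<^sub>m d" using X X' Y' XY by simp
  have "Y' * X' \<in> carrier_mat d d" using X' Y' by simp
  note inv = this inv1 mat_mult_left_right_inverse[OF Ac this inv1]
  obtain p q where p: "p \<in> symmetric_mats d" and q: "q \<in> symmetric_mats d"
    and eq: "unit_upper d r * H = unit_lower d p * (block_diag_symplectic d ?A (Y' * X') * unit_upper d q)"
    using SP_lower_diag_upper[OF Ac Bc C D sp inv] H' by auto
  obtain a1 S1 T1 b1 where w1: "a1 \<in> symmetric_mats d" "S1 \<in> symmetric_mats d" "T1 \<in> symmetric_mats d" "b1 \<in> symmetric_mats d"
    and eq1: "block_diag_symplectic d X X' = unit_lower d a1 * (unit_upper d S1 * (unit_lower d T1 * unit_upper d b1))"
    using block_diag_symplectic_word[OF pair(1) X X'] by blast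
  obtain a2 S2 T2 b2 where w2: "a2 \<in> symmetric_mats d" "S2 \<in> symmetric_mats d" "T2 \<in> symmetric_mats d" "b2 \<in> symmetric_mats d"
    and eq2: "block_diag_symplectic d Y Y' = unit_lower d a2 * (unit_upper d S2 * (unit_lower d T2 * unit_upper d b2))"
    using block_diag_symplectic_word[OF pair(2) Y Y'] by blast
  note c = symmetric_matsD(1)[OF p] symmetric_matsD(1)[OF q] w1[THEN symmetric_matsD(1)] w2[THEN symmetric_matsD(1)]
  note car = c[THEN unit_triangular_carrier(1)] c[THEN unit_triangular_carrier(2)]
    unit_triangular_carrier(1)[OF rc] unit_triangular_carrier(1)[OF mrc]
  have Hc: "H \<in> carrier_mat (2 * d) (2 * d)" using H by (simp add: SP_def)
  note asc = assoc_mult_mat[of _ "2 * d" "2 * d" _ "2 * d" _ "2 * d"]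
  have r0: "- r + r = 0\<^sub>m d d" using rc by (intro eq_matI) auto
  have "H = (unit_upper d (- r) * unit_upper d r) * H"
    using Hc by (simp add: unit_upper_add[OF mrc rc] r0 unit_upper_zero)
  also have "\<dots> = unit_upper d (- r) * (unit_lower d p *
      (block_diag_symplectic d X X' * block_diag_symplectic d Y Y' * unit_upper d q))"
    using Hc car by (simp add: asc eq XY block_diag_symplectic_mult[OF X X'(1) Y Y'(1)])
  also have "\<dots> = unit_upper d (- r) * ((unit_lower d p * unit_lower d a1) *
      (unit_upper d S1 * (unit_lower d T1 * (unit_upper d b1 * (unit_lower d a2 *
      (unit_upper d S2 * (unit_lower d T2 * (unit_upper d b2 * unit_upper d q))))))))"
    unfolding eq1 eq2 using car by (simp add: asc)
  finally have Hw: "H = unit_upper d (- r) * (unit_lower d (p + a1) *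
      (unit_upper d S1 * (unit_lower d T1 * (unit_upper d b1 * (unit_lower d a2 *
      (unit_upper d S2 * (unit_lower d T2 * unit_upper d (b2 + q))))))))"
    using c by (simp add: unit_lower_add unit_upper_add)
  \<comment> \<open>The default value \<open>b2 + q\<close> serves index 1, the rightmost factor,
    and keeps \<open>S i\<close> symmetric at every other index too.\<close>
  define S where "S = (\<lambda>_ :: nat. b2 + q)(9 := - r, 8 := p + a1, 7 := S1, 6 := T1, 5 := b1, 4 := a2, 3 := S2, 2 := T2)"
  have "S i \<in> symmetric_mats d" for i
    using w1 w2 p q r by (simp add: S_def symmetric_mats_add symmetric_mats_uminus)
  moreover have "b2 + q \<in> carrier_mat d d" using c by simp
  then have "H = alt_prod d S 9"
    unfolding Hw using right_mult_one_mat[OF unit_triangular_carrier(1)]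
    by (simp add: alt_prod_numeral alt_factor_def S_def)
  ultimately show ?thesis by blast
qed

theorem theorem6:
  fixes d :: nat
  assumes "d \<ge> 1"
  shows "SP d = L_set d 9 \<and>
    (\<forall>H\<in>SP d. \<exists>Ms. length Ms \<le> 9 \<and> set Ms \<subseteq> unit_triangular_symplectic d \<and>
       H = foldr (*) Ms (1\<^sub>m (2 * d)))"
proof
  show "SP d = L_set d 9"
    using SP_word alt_prod_mem_SP unfolding L_set_def by blast
  show "\<forall>H\<in>SP d. \<exists>Ms. length Ms \<le> 9 \<and> set Ms \<subseteq> unit_triangular_symplectic d \<and>
       H = foldr (*) Ms (1\<^sub>m (2 * d))"
  proof
    fix H assume "H \<in> SP d"
    then obtain S where S: "\<And>i. S i \<in> symmetric_mats d" and H: "H = alt_prod d S 9"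
      using SP_word by blast
    let ?Ms = "map (alt_factor d S) (rev [1..<Suc 9])"
    have "length ?Ms \<le> 9" by simp
    moreover have "set ?Ms \<subseteq> unit_triangular_symplectic d"
      using S by (auto simp: alt_factor_def unit_triangular_symplectic_def)
    moreover have "H = foldr (*) ?Ms (1\<^sub>m (2 * d))"
      unfolding H by (rule alt_prod_eq_foldr)
    ultimately show "\<exists>Ms. length Ms \<le> 9 \<and> set Ms \<subseteq> unit_triangular_symplectic d \<and>
       H = foldr (*) Ms (1\<^sub>m (2 * d))" by blast
  qed
qed

end
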